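(* Let $U_{\vec a,\sigma}$ be a totally umbilical surface of the unit sphere $\mathbb{S}^3$ with mean curvature $H$, and let $\alpha\colon I\subset\mathbb{R}\to\mathbb{S}^3$ be a regular curve with curvature $\kappa$ and torsion $\tau$. (1) Case $\sigma=0$. If $\alpha$ is contained in $U_{\vec a,0}$, then $\tau=0$ identically on $I$. (2) Case $\sigma\neq 0$. If $\alpha$ is contained in $U_{\vec a,\sigma}$ and $\tau\neq 0$ everywhere on $I$, then $$\frac{1}{\kappa^2}+\frac{\kappa'^2}{\kappa^4\tau^2}=\frac{1}{H^2}\quad\text{on } I.$$ Conversely: if $\tau=0$ identically on $I$, then $\alpha$ is contained in a totally geodesic sphere of $\mathbb{S}^3$. If $\tau\neq0$ and $\kappa'\neq 0$ everywhere on $I$ and there is a constant $C>0$ such that $$\frac{1}{\kappa^2}+\frac{\kappa'^2}{\kappa^4\tau^2}=C\quad\text{on } I,$$ then $\alpha$ is contained in some geodesic sphere of $\mathbb{S}^3$ whose mean curvature $H$ satisfies $C=1/H^2$.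
   Context: Model: $\mathbb{S}^3=\{p\in\mathbb{R}^4:\langle p,p\rangle=1\}$ with $\langle\cdot,\cdot\rangle$ the Euclidean metric of $\mathbb{R}^4$, endowed with the induced metric and Levi-Civita connection $\nabla$. Totally umbilical surfaces: these are the sets $U_{\vec a,\sigma}=\{p\in\mathbb{S}^3:\langle p,\vec a\rangle=\sigma\}$ with $\vec a\in\mathbb{R}^4$, $\langle\vec a,\vec a\rangle=1$, $\sigma\in(-1,1)$. They are called totally geodesic spheres (great spheres) if $\sigma=0$ and geodesic spheres if $\sigma\neq0$. The mean curvature (the common value of the principal curvatures, for a suitable choice of unit normal) is the constant $H=\sigma/\sqrt{1-\sigma^2}$. Curves: $I$ is an open interval; curves are of class at least $C^4$, parametrized by arc length $s$, and non-geodesic in the sense that $\kappa>0$ everywhere. The prime denotes $d/ds$. The curvature $\kappa$ and torsion $\tau$ are defined by the Frenet frame $\{T,N,B\}$ (orthonormal frame of $\mathbb{S}^3$ along $\alpha$, $T=\alpha'$, positively oriented for a fixed orientation) with $\nabla_TT=\kappa N$, $\nabla_TN=-\kappa T+\tau B$, $\nabla_TB=-\tau N$. "$\alpha$ is contained in $S$" means $\alpha(I)\subset S$. *)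

theory Defs
  imports "HOL-Analysis.Analysis"
begin

abbreviation S3 :: "(real^4) set" where
  "S3 \<equiv> sphere 0 1"

text \<open>Orthogonal projection of \<open>\<real>\<^sup>4\<close> onto the tangent space of \<open>S3\<close> at \<open>p\<close>. Composed with the
  derivative of \<open>\<real>\<^sup>4\<close> it gives the Levi-Civita connection of the induced metric.\<close>

definition tangential :: "real^4 \<Rightarrow> real^4 \<Rightarrow> real^4" where
  "tangential p w = w - (w \<bullet> p) *\<^sub>R p"

definition covariant_deriv :: "(real \<Rightarrow> real^4) \<Rightarrow> (real \<Rightarrow> real^4) \<Rightarrow> real \<Rightarrow> real^4" where
  "covariant_deriv \<alpha> X s = tangential (\<alpha> s) (vector_derivative X (at s))"

definition open_interval :: "real set \<Rightarrow> bool" where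
  "open_interval I \<longleftrightarrow> open I \<and> is_interval I \<and> I \<noteq> {}"

text \<open>Class \<open>C\<^sup>k\<close>, for an open set \<open>I\<close>.\<close>

fun Ck_on :: "nat \<Rightarrow> (real \<Rightarrow> 'a::real_normed_vector) \<Rightarrow> real set \<Rightarrow> bool" where
  "Ck_on 0 f I \<longleftrightarrow> continuous_on I f"
| "Ck_on (Suc k) f I \<longleftrightarrow>
     (\<forall>s\<in>I. f differentiable (at s)) \<and> Ck_on k (\<lambda>s. vector_derivative f (at s)) I"

definition arclength_curve :: "real set \<Rightarrow> (real \<Rightarrow> real^4) \<Rightarrow> bool" where
  "arclength_curve I \<alpha> \<longleftrightarrow>
     open_interval I \<and> Ck_on 4 \<alpha> I \<and>
     (\<forall>s\<in>I. \<alpha> s \<in> S3 \<and> norm (vector_derivative \<alpha> (at s)) = 1)"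

text \<open>\<open>\<epsilon> = \<plusminus>1\<close> selects one of the two orientations of \<open>S3\<close>: a tangent frame \<open>(u, v, w)\<close> at \<open>p\<close> is
  positive if the basis \<open>(p, u, v, w)\<close> of \<open>\<real>\<^sup>4\<close> has a determinant with the sign of \<open>\<epsilon>\<close>.
  A curve with a Frenet frame has \<open>\<kappa> > 0\<close>, i.e. is nowhere geodesic.\<close>

definition frenet_frame ::
  "real \<Rightarrow> real set \<Rightarrow> (real \<Rightarrow> real^4) \<Rightarrow> (real \<Rightarrow> real^4) \<Rightarrow> (real \<Rightarrow> real^4) \<Rightarrow> (real \<Rightarrow> real^4)
    \<Rightarrow> (real \<Rightarrow> real) \<Rightarrow> (real \<Rightarrow> real) \<Rightarrow> bool" where
  "frenet_frame \<epsilon> I \<alpha> T N B \<kappa> \<tau> \<longleftrightarrow>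
     (\<forall>s\<in>I.
        T s = vector_derivative \<alpha> (at s) \<and>
        T differentiable (at s) \<and> N differentiable (at s) \<and> B differentiable (at s) \<and>
        T s \<bullet> \<alpha> s = 0 \<and> N s \<bullet> \<alpha> s = 0 \<and> B s \<bullet> \<alpha> s = 0 \<and>
        norm (T s) = 1 \<and> norm (N s) = 1 \<and> norm (B s) = 1 \<and>
        T s \<bullet> N s = 0 \<and> T s \<bullet> B s = 0 \<and> N s \<bullet> B s = 0 \<and>
        \<epsilon> * det (vector [\<alpha> s, T s, N s, B s] :: real^4^4) > 0 \<and>
        \<kappa> s > 0 \<and>
        covariant_deriv \<alpha> T s = \<kappa> s *\<^sub>R N s \<and>
        covariant_deriv \<alpha> N s = - \<kappa> s *\<^sub>R T s + \<tau> s *\<^sub>R B s \<and>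
        covariant_deriv \<alpha> B s = - \<tau> s *\<^sub>R N s)"

definition umbilical :: "real^4 \<Rightarrow> real \<Rightarrow> (real^4) set" where
  "umbilical a \<sigma> = {p \<in> S3. p \<bullet> a = \<sigma>}"

definition totally_geodesic_sphere :: "(real^4) set \<Rightarrow> bool" where
  "totally_geodesic_sphere M \<longleftrightarrow> (\<exists>a. norm a = 1 \<and> M = umbilical a 0)"

definition geodesic_sphere :: "(real^4) set \<Rightarrow> bool" where
  "geodesic_sphere M \<longleftrightarrow>
     (\<exists>a \<sigma>. norm a = 1 \<and> -1 < \<sigma> \<and> \<sigma> < 1 \<and> \<sigma> \<noteq> 0 \<and> M = umbilical a \<sigma>)"

definition tangent_space :: "(real^4) set \<Rightarrow> real^4 \<Rightarrow> (real^4) set" where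
  "tangent_space M p =
     {v. \<exists>\<gamma>. \<gamma> 0 = p \<and> eventually (\<lambda>t. \<gamma> t \<in> M) (nhds (0::real)) \<and>
            (\<gamma> has_vector_derivative v) (at 0)}"

text \<open>For a surface \<open>M\<close> in \<open>S3\<close>: with respect to some unit normal field \<open>\<nu>\<close>, the shape operator
  \<open>v \<mapsto> - \<nabla>\<^sub>v \<nu>\<close> is \<open>H\<close> times the identity at every point, so that all principal curvatures are
  equal to \<open>H\<close>. The value \<open>H\<close> is determined up to the sign that comes with the choice of \<open>\<nu>\<close>.\<close>

definition umbilical_with_mean_curvature :: "(real^4) set \<Rightarrow> real \<Rightarrow> bool" where
  "umbilical_with_mean_curvature M H \<longleftrightarrow>
     (\<exists>\<nu>. (\<forall>p\<in>M. norm (\<nu> p) = 1 \<and> \<nu> p \<bullet> p = 0 \<and> (\<forall>v\<in>tangent_space M p. \<nu> p \<bullet> v = 0)) \<and>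
          (\<forall>p\<in>M. \<exists>D. (\<nu> has_derivative D) (at p within M) \<and>
                     (\<forall>v\<in>tangent_space M p. - tangential p (D v) = H *\<^sub>R v)))"

lemma tangent_space_umbilical:
  assumes "v \<in> tangent_space (umbilical a \<sigma>) p"
  shows "v \<bullet> p = 0" and "v \<bullet> a = 0"
proof -
  obtain \<gamma> where g: "\<gamma> 0 = p" "eventually (\<lambda>t. \<gamma> t \<in> umbilical a \<sigma>) (nhds (0::real))"
      "(\<gamma> has_vector_derivative v) (at 0)"
    using assms by (auto simp: tangent_space_def)
  have d: "(\<gamma> has_derivative (\<lambda>t. t *\<^sub>R v)) (at 0)"
    using g(3) by (simp add: has_vector_derivative_def)
  have ev: "eventually (\<lambda>t. \<gamma> t \<bullet> \<gamma> t = 1 \<and> \<gamma> t \<bullet> a = \<sigma>) (nhds (0::real))"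
    by (rule eventually_mono[OF g(2)]) (auto simp: umbilical_def dot_square_norm)
  have "((\<lambda>t. \<gamma> t \<bullet> \<gamma> t) has_derivative (\<lambda>t. 2 * t * (v \<bullet> p))) (at 0)"
    by (rule has_derivative_eq_rhs[OF has_derivative_inner[OF d d]])
      (auto simp: g(1) inner_commute)
  moreover have "((\<lambda>t. \<gamma> t \<bullet> \<gamma> t) has_derivative (\<lambda>t. 0)) (at 0)"
    by (rule has_derivative_transform_eventually[OF has_derivative_const[of "1"]])
      (use ev in \<open>auto simp: eventually_at_filter elim: eventually_mono
        dest: eventually_nhds_x_imp_x\<close>)
  ultimately have "(\<lambda>t. 2 * t * (v \<bullet> p)) = (\<lambda>t. 0)"
    by (rule has_derivative_unique)
  from fun_cong[OF this, of 1] show "v \<bullet> p = 0" by simp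
  have "((\<lambda>t. \<gamma> t \<bullet> a) has_derivative (\<lambda>t. t * (v \<bullet> a))) (at 0)"
    by (rule has_derivative_eq_rhs[OF has_derivative_inner_left[OF d]]) auto
  moreover have "((\<lambda>t. \<gamma> t \<bullet> a) has_derivative (\<lambda>t. 0)) (at 0)"
    by (rule has_derivative_transform_eventually[OF has_derivative_const[of "\<sigma>"]])
      (use ev in \<open>auto simp: eventually_at_filter elim: eventually_mono
        dest: eventually_nhds_x_imp_x\<close>)
  ultimately have "(\<lambda>t. t * (v \<bullet> a)) = (\<lambda>t. 0)"
    by (rule has_derivative_unique)
  from fun_cong[OF this, of 1] show "v \<bullet> a = 0" by simp
qed

lemma umbilical_mean_curvature:
  assumes "norm a = 1" "-1 < \<sigma>" "\<sigma> < 1"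
  shows "umbilical_with_mean_curvature (umbilical a \<sigma>) (\<sigma> / sqrt (1 - \<sigma>\<^sup>2))"
proof -
  define r where "r = sqrt (1 - \<sigma>\<^sup>2)"
  have pos: "\<sigma>\<^sup>2 < 1"
    using assms by (simp add: abs_square_less_1 abs_less_iff)
  then have r: "r > 0" "r\<^sup>2 = 1 - \<sigma>\<^sup>2"
    by (simp_all add: r_def)
  define \<nu> where "\<nu> p = (1 / r) *\<^sub>R (a - \<sigma> *\<^sub>R p)" for p
  have aa: "a \<bullet> a = 1"
    using assms by (simp add: dot_square_norm)
  have U: "p \<bullet> p = 1" "p \<bullet> a = \<sigma>" "a \<bullet> p = \<sigma>" if "p \<in> umbilical a \<sigma>" for p
    using that by (auto simp: umbilical_def dot_square_norm inner_commute)
  have "(a - \<sigma> *\<^sub>R p) \<bullet> (a - \<sigma> *\<^sub>R p) = r\<^sup>2" if "p \<in> umbilical a \<sigma>" for p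
    using U[OF that] aa r by (simp add: inner_diff_left inner_diff_right power2_eq_square)
  then have "norm (\<nu> p) = 1" if "p \<in> umbilical a \<sigma>" for p
    using that r(1) by (simp add: \<nu>_def norm_eq_sqrt_inner power2_eq_square)
  moreover have "\<nu> p \<bullet> p = 0" if "p \<in> umbilical a \<sigma>" for p
    using U[OF that] by (simp add: \<nu>_def inner_diff_left)
  moreover have "\<nu> p \<bullet> v = 0" if "v \<in> tangent_space (umbilical a \<sigma>) p" for p v
    using tangent_space_umbilical[OF that] by (simp add: \<nu>_def inner_diff_left inner_diff_right inner_commute)
  moreover have "(\<nu> has_derivative (\<lambda>v. (1 / r) *\<^sub>R (- \<sigma> *\<^sub>R v))) (at p within M)" for p M
    unfolding \<nu>_def by (auto intro!: derivative_eq_intros)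
  moreover have "- tangential p ((1 / r) *\<^sub>R (- \<sigma> *\<^sub>R v)) = (\<sigma> / r) *\<^sub>R v"
    if "v \<in> tangent_space (umbilical a \<sigma>) p" for p v
    using tangent_space_umbilical[OF that] by (simp add: tangential_def)
  ultimately show ?thesis
    unfolding umbilical_with_mean_curvature_def r_def[symmetric] by blast
qed

end

theory Submission imports Defs
begin

text \<open>
  Everything is read off from the orthonormal frame \<open>(\<alpha>, T, N, B)\<close> of \<open>\<real>\<^sup>4\<close> along the curve. As ambient
  derivatives, the Frenet equations are \<open>\<alpha>' = T\<close>, \<open>T' = \<kappa>N - \<alpha>\<close>, \<open>N' = -\<kappa>T + \<tau>B\<close>, \<open>B' = -\<tau>N\<close>.

  On a great sphere with pole \<open>a\<close>, differentiating \<open>\<alpha> \<bullet> a = 0\<close> repeatedly shows that \<open>a\<close> is orthogonal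
  to \<open>\<alpha>\<close>, \<open>T\<close> and \<open>N\<close>, hence parallel to \<open>B\<close>, and one more derivative gives \<open>\<tau> = 0\<close>. Conversely
  \<open>\<tau> = 0\<close> makes \<open>B\<close> constant, and \<open>B\<close> is the pole of a great sphere through the curve.

  On a totally umbilical surface, let \<open>n\<close> be the unit normal of the surface along the curve. The shape
  operator gives \<open>n' = -HT\<close>. Differentiating \<open>n \<bullet> T = 0\<close> yields \<open>n \<bullet> N = H/\<kappa>\<close>, and differentiating this
  yields \<open>n \<bullet> B = H (1/\<kappa>)'/\<tau>\<close>. Since \<open>n\<close> is orthogonal to \<open>\<alpha>\<close> and \<open>T\<close>, the equation \<open>|n| = 1\<close> is the
  identity between curvature and torsion, multiplied by \<open>H\<^sup>2\<close> (lemmas \<open>unit_normal_along_curve\<close> and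
  \<open>umbilical_curvature_torsion_identity\<close>).

  Conversely, \<open>H \<alpha> + n\<close> is constant along a curve on such a surface. Dividing by \<open>H\<close> suggests the
  vector \<open>A = \<alpha> + \<rho>N + \<mu>B\<close> with \<open>\<rho> = 1/\<kappa>\<close> and \<open>\<mu> = \<rho>'/\<tau>\<close>. The Frenet equations give
  \<open>A' = (\<rho>\<tau> + \<mu>')B\<close>, and the derivative of \<open>\<rho>\<^sup>2 + \<mu>\<^sup>2 = C\<close> is \<open>2\<mu>(\<rho>\<tau> + \<mu>') = 0\<close>, where \<open>\<kappa>' \<noteq> 0\<close>
  makes \<open>\<mu> \<noteq> 0\<close>. So \<open>A\<close> is constant, and \<open>\<alpha> \<bullet> A = 1\<close>, \<open>|A|\<^sup>2 = 1 + C\<close> describe a geodesic sphere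
  (lemma \<open>in_geodesic_sphere_if_identity\<close>). This requires \<open>\<kappa>'\<close> and \<open>\<tau>\<close> to be differentiable, which
  comes from the fourth derivative of \<open>\<alpha>\<close> (lemma \<open>curvature_torsion_differentiable\<close>).
\<close>

section \<open>Calculus and linear algebra preliminaries\<close>

text \<open>The matrix with these rows is orthogonal, so it preserves the norm of \<open>v\<close>, and its product
  with \<open>v\<close> has the inner products \<open>v \<bullet> e\<^sub>i\<close> as entries.\<close>
lemma orthonormal_basis_Parseval:
  fixes e1 e2 e3 e4 v :: "real^4"
  assumes "norm e1 = 1" "norm e2 = 1" "norm e3 = 1" "norm e4 = 1"
    and "e1 \<bullet> e2 = 0" "e1 \<bullet> e3 = 0" "e1 \<bullet> e4 = 0" "e2 \<bullet> e3 = 0" "e2 \<bullet> e4 = 0" "e3 \<bullet> e4 = 0"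
  shows "(norm v)\<^sup>2 = (v \<bullet> e1)\<^sup>2 + (v \<bullet> e2)\<^sup>2 + (v \<bullet> e3)\<^sup>2 + (v \<bullet> e4)\<^sup>2"
proof -
  define Q :: "real^4^4"
    where "Q = (\<chi> i. if i = 1 then e1 else if i = 2 then e2 else if i = 3 then e3 else e4)"
  have rows: "Q $ 1 = e1" "Q $ 2 = e2" "Q $ 3 = e3" "Q $ 4 = e4"
    by (simp_all add: Q_def)
  have row_Q: "row i Q = Q $ i" for i
    by (simp add: row_def vec_eq_iff)
  have inj: "e1 \<noteq> e2" "e1 \<noteq> e3" "e1 \<noteq> e4" "e2 \<noteq> e3" "e2 \<noteq> e4" "e3 \<noteq> e4"
    using assms by auto
  have "orthogonal_matrix Q"
    unfolding orthogonal_matrix_orthonormal_rows row_Q forall_4 rows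
    using assms inj by (auto simp: orthogonal_def inner_commute)
  then have "orthogonal_transformation ((*v) Q)"
    by (simp add: orthogonal_transformation_matrix)
  then have "norm (Q *v v) = norm v"
    by (rule orthogonal_transformation_norm)
  moreover have "(norm (Q *v v))\<^sup>2 = (\<Sum>i\<in>UNIV. (v \<bullet> Q $ i)\<^sup>2)"
    unfolding power2_norm_eq_inner inner_vec_def[of "Q *v v"]
    by (simp add: matrix_vector_mul_component inner_commute power2_eq_square)
  then have "(norm (Q *v v))\<^sup>2 = (v \<bullet> e1)\<^sup>2 + (v \<bullet> e2)\<^sup>2 + (v \<bullet> e3)\<^sup>2 + (v \<bullet> e4)\<^sup>2"
    by (simp only: sum_4 rows)
  ultimately show ?thesis by simp
qed

lemma has_real_derivative_inner:
  fixes f g :: "real \<Rightarrow> 'a::real_inner"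
  assumes "(f has_vector_derivative f') (at s)" "(g has_vector_derivative g') (at s)"
  shows "((\<lambda>t. f t \<bullet> g t) has_real_derivative f s \<bullet> g' + f' \<bullet> g s) (at s)"
  using bounded_bilinear.has_vector_derivative[OF bounded_bilinear_inner assms]
  by (simp add: has_real_derivative_iff_has_vector_derivative)

text \<open>This is the form in which identities along the curve, such as \<open>N \<bullet> \<alpha> = 0\<close>, are
  differentiated: both sides are differentiated by rule, and the two results agree.\<close>
lemma derivatives_eq_if_eq_on_open:
  fixes f g :: "real \<Rightarrow> real"
  assumes "(f has_real_derivative f') (at s)" "(g has_real_derivative g') (at s)"
    and "open I" "s \<in> I" "\<And>t. t \<in> I \<Longrightarrow> f t = g t"
  shows "f' = g'"
  using has_field_derivative_transform_within_open[OF assms(1,3-5)] assms(2)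
  by (rule DERIV_unique)

section \<open>The Frenet equations in Euclidean space\<close>

locale frenet_curve =
  fixes \<alpha> T N B :: "real \<Rightarrow> real^4" and \<kappa> \<tau> :: "real \<Rightarrow> real" and I :: "real set" and \<epsilon> :: real
  assumes curve: "arclength_curve I \<alpha>"
    and frame: "frenet_frame \<epsilon> I \<alpha> T N B \<kappa> \<tau>"
begin

lemma interval: "open I" "convex I" "I \<noteq> {}"
  using curve by (auto simp: arclength_curve_def open_interval_def is_interval_convex)

lemma on_S3: "norm (\<alpha> s) = 1" if "s \<in> I"
  using curve that by (auto simp: arclength_curve_def)

lemma orthonormal:
  assumes "s \<in> I"
  shows "\<alpha> s \<bullet> \<alpha> s = 1" "T s \<bullet> T s = 1" "N s \<bullet> N s = 1" "B s \<bullet> B s = 1"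
    and "\<alpha> s \<bullet> T s = 0" "\<alpha> s \<bullet> N s = 0" "\<alpha> s \<bullet> B s = 0"
    and "T s \<bullet> \<alpha> s = 0" "N s \<bullet> \<alpha> s = 0" "B s \<bullet> \<alpha> s = 0"
    and "T s \<bullet> N s = 0" "T s \<bullet> B s = 0" "N s \<bullet> B s = 0"
    and "N s \<bullet> T s = 0" "B s \<bullet> T s = 0" "B s \<bullet> N s = 0"
  using frame on_S3[OF assms] assms
  by (auto simp: frenet_frame_def dot_square_norm inner_commute)

lemma curvature_pos: "\<kappa> s > 0" if "s \<in> I"
  using frame that by (auto simp: frenet_frame_def)

lemma norm_frame_components:
  assumes "s \<in> I"
  shows "(norm v)\<^sup>2 = (v \<bullet> \<alpha> s)\<^sup>2 + (v \<bullet> T s)\<^sup>2 + (v \<bullet> N s)\<^sup>2 + (v \<bullet> B s)\<^sup>2"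
  by (rule orthonormal_basis_Parseval) (simp_all add: norm_eq_1 orthonormal[OF assms])

lemma curve_deriv: "(\<alpha> has_vector_derivative T s) (at s)" if "s \<in> I"
proof -
  have "Ck_on (Suc 3) \<alpha> I"
    using curve by (simp add: arclength_curve_def eval_nat_numeral)
  then have "\<alpha> differentiable (at s)"
    unfolding Ck_on.simps using that by blast
  then show ?thesis
    using frame that by (simp add: frenet_frame_def flip: vector_derivative_works)
qed

text \<open>The covariant derivative drops the component of \<open>X'\<close> along \<open>\<alpha>\<close>. Differentiating \<open>X \<bullet> \<alpha> = 0\<close>
  recovers that component as \<open>- X \<bullet> T\<close>, so a covariant equation becomes one in \<open>\<real>\<^sup>4\<close>.\<close>
lemma derivative_of_section:
  assumes s: "s \<in> I" and d: "X differentiable (at s)" and orth: "\<And>t. t \<in> I \<Longrightarrow> X t \<bullet> \<alpha> t = 0"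
  shows "(X has_vector_derivative covariant_deriv \<alpha> X s - (X s \<bullet> T s) *\<^sub>R \<alpha> s) (at s)"
proof -
  have X: "(X has_vector_derivative vector_derivative X (at s)) (at s)"
    using d by (simp add: vector_derivative_works)
  have "X s \<bullet> T s + vector_derivative X (at s) \<bullet> \<alpha> s = 0"
    by (rule derivatives_eq_if_eq_on_open[OF has_real_derivative_inner[OF X curve_deriv[OF s]]
          DERIV_const[of 0] interval(1) s]) (simp add: orth)
  then have "vector_derivative X (at s) \<bullet> \<alpha> s = - (X s \<bullet> T s)"
    by simp
  then have "vector_derivative X (at s) = covariant_deriv \<alpha> X s - (X s \<bullet> T s) *\<^sub>R \<alpha> s"
    by (simp add: covariant_deriv_def tangential_def)
  with X show ?thesis by simp
qed

lemma tangent_deriv: "(T has_vector_derivative \<kappa> s *\<^sub>R N s - \<alpha> s) (at s)" if "s \<in> I"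
  using derivative_of_section[of s T] frame that orthonormal by (simp add: frenet_frame_def)

lemma normal_deriv: "(N has_vector_derivative - \<kappa> s *\<^sub>R T s + \<tau> s *\<^sub>R B s) (at s)" if "s \<in> I"
  using derivative_of_section[of s N] frame that orthonormal by (simp add: frenet_frame_def)

lemma binormal_deriv: "(B has_vector_derivative - \<tau> s *\<^sub>R N s) (at s)" if "s \<in> I"
  using derivative_of_section[of s B] frame that orthonormal by (simp add: frenet_frame_def)

section \<open>Regularity of curvature and torsion\<close>

text \<open>The function \<open>J\<close> is the third derivative of \<open>\<alpha>\<close>, because \<open>\<kappa> N - \<alpha>\<close> is the second one. The
  differentiability of \<open>J\<close> is the point where the class \<open>C\<^sup>4\<close> is used.\<close>
lemma third_derivative:
  obtains J where
    "\<And>s. s \<in> I \<Longrightarrow> ((\<lambda>t. \<kappa> t *\<^sub>R N t - \<alpha> t) has_vector_derivative J s) (at s)"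
    "\<And>s. s \<in> I \<Longrightarrow> J differentiable (at s)"
proof -
  define D1 where "D1 = (\<lambda>s. vector_derivative \<alpha> (at s))"
  define D2 where "D2 = (\<lambda>s. vector_derivative D1 (at s))"
  define D3 where "D3 = (\<lambda>s. vector_derivative D2 (at s))"
  have "Ck_on (Suc (Suc (Suc (Suc 0)))) \<alpha> I"
    using curve by (simp add: arclength_curve_def eval_nat_numeral)
  then have diff: "D2 differentiable (at s)" "D3 differentiable (at s)" if "s \<in> I" for s
    using that unfolding Ck_on.simps D1_def[symmetric] D2_def[symmetric] D3_def[symmetric] by auto
  have D1: "D1 s = T s" if "s \<in> I" for s
    using frame that by (simp add: frenet_frame_def D1_def)
  have D2: "D2 s = \<kappa> s *\<^sub>R N s - \<alpha> s" if "s \<in> I" for s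
    unfolding D2_def
    by (rule vector_derivative_at[OF has_vector_derivative_transform_within_open
          [OF tangent_deriv[OF that] interval(1) that]]) (simp add: D1)
  have "((\<lambda>t. \<kappa> t *\<^sub>R N t - \<alpha> t) has_vector_derivative D3 s) (at s)" if "s \<in> I" for s
  proof (rule has_vector_derivative_transform_within_open[OF _ interval(1) that])
    show "(D2 has_vector_derivative D3 s) (at s)"
      using diff(1)[OF that] by (simp add: vector_derivative_works D3_def)
  qed (simp add: D2)
  with diff(2) show ?thesis by (rule that[rotated])
qed

text \<open>The frame is known to be differentiable only once, so \<open>\<kappa>'\<close> and \<open>\<tau>\<close> have to be expressed by the
  frame and by derivatives of \<open>\<alpha>\<close>: they are \<open>\<kappa>' = T'' \<bullet> N\<close> and \<open>\<tau> = (T'' \<bullet> B) / \<kappa>\<close>.\<close>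
lemma curvature_torsion_differentiable:
  assumes s: "s \<in> I"
  shows "\<kappa> differentiable (at s)" "deriv \<kappa> differentiable (at s)" "\<tau> differentiable (at s)"
proof -
  obtain J where J: "\<And>s. s \<in> I \<Longrightarrow> ((\<lambda>t. \<kappa> t *\<^sub>R N t - \<alpha> t) has_vector_derivative J s) (at s)"
    and Jd: "\<And>s. s \<in> I \<Longrightarrow> J differentiable (at s)"
    using third_derivative by blast
  have \<kappa>: "(\<kappa> has_real_derivative J t \<bullet> N t) (at t)" if t: "t \<in> I" for t
  proof (rule has_field_derivative_transform_within_open[OF _ interval(1) t])
    have "(\<kappa> t *\<^sub>R N t - \<alpha> t) \<bullet> (- \<kappa> t *\<^sub>R T t + \<tau> t *\<^sub>R B t) = 0"
      by (simp add: inner_diff_left inner_diff_right orthonormal[OF t])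
    with has_real_derivative_inner[OF J[OF t] normal_deriv[OF t]]
    show "((\<lambda>t. (\<kappa> t *\<^sub>R N t - \<alpha> t) \<bullet> N t) has_real_derivative J t \<bullet> N t) (at t)"
      by (simp only: add_0)
  qed (simp add: inner_diff_left orthonormal)
  then show "\<kappa> differentiable (at s)"
    using s real_differentiable_def by blast
  \<comment> \<open>Both \<open>\<kappa>'\<close> and \<open>\<kappa>\<tau>\<close> are inner products of \<open>J\<close> with a vector of the frame.\<close>
  have diff_inner: "\<exists>d. ((\<lambda>t. J t \<bullet> X t) has_real_derivative d) (at s)"
    if "(X has_vector_derivative X') (at s)" for X X'
    using has_real_derivative_inner[OF _ that] Jd[OF s] vector_derivative_works by blast
  obtain d where "((\<lambda>t. J t \<bullet> N t) has_real_derivative d) (at s)"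
    using diff_inner[OF normal_deriv[OF s]] by blast
  then have "(deriv \<kappa> has_real_derivative d) (at s)"
    by (rule has_field_derivative_transform_within_open[OF _ interval(1) s])
      (metis \<kappa> DERIV_imp_deriv)
  then show "deriv \<kappa> differentiable (at s)"
    using real_differentiable_def by blast
  \<comment> \<open>Differentiate \<open>(\<kappa>N - \<alpha>) \<bullet> B = 0\<close>.\<close>
  have JB: "J t \<bullet> B t = \<kappa> t * \<tau> t" if t: "t \<in> I" for t
  proof -
    have "- \<kappa> t * \<tau> t + J t \<bullet> B t = 0"
      using derivatives_eq_if_eq_on_open[OF has_real_derivative_inner[OF J[OF t] binormal_deriv[OF t]]
          DERIV_const[of 0] interval(1) t]
      by (simp add: inner_diff_left orthonormal t)
    then show ?thesis by simp
  qed
  obtain d' where "((\<lambda>t. J t \<bullet> B t) has_real_derivative d') (at s)"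
    using diff_inner[OF binormal_deriv[OF s]] by blast
  from DERIV_divide[OF this \<kappa>[OF s]] curvature_pos[OF s]
  obtain d'' where "((\<lambda>t. (J t \<bullet> B t) / \<kappa> t) has_real_derivative d'') (at s)"
    by fastforce
  then have "(\<tau> has_real_derivative d'') (at s)"
  proof (rule has_field_derivative_transform_within_open[OF _ interval(1) s])
    fix t assume "t \<in> I"
    then show "J t \<bullet> B t / \<kappa> t = \<tau> t"
      using JB curvature_pos[of t] by simp
  qed
  then show "\<tau> differentiable (at s)"
    using real_differentiable_def by blast
qed

lemma curvature_deriv: "(\<kappa> has_real_derivative deriv \<kappa> s) (at s)" if "s \<in> I"
  using curvature_torsion_differentiable(1)[OF that] DERIV_deriv_iff_real_differentiable by blast

lemma radius_deriv:
  assumes s: "s \<in> I"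
  shows "((\<lambda>t. 1 / \<kappa> t) has_real_derivative - deriv \<kappa> s / (\<kappa> s)\<^sup>2) (at s)"
  using curvature_pos[OF s]
  by (auto intro!: derivative_eq_intros curvature_deriv[OF s] simp: power2_eq_square)

section \<open>Curves on totally umbilical surfaces\<close>

lemma torsion_zero_if_in_great_sphere:
  assumes a: "norm a = 1" and sub: "\<alpha> ` I \<subseteq> umbilical a 0" and s: "s \<in> I"
  shows "\<tau> s = 0"
proof -
  have \<alpha>: "\<alpha> t \<bullet> a = 0" if "t \<in> I" for t
    using sub that by (auto simp: umbilical_def)
  \<comment> \<open>Orthogonality to \<open>a\<close> passes from a field along the curve to its derivative.\<close>
  have step: "X' \<bullet> a = 0"
    if "t \<in> I" "(X has_vector_derivative X') (at t)" "\<And>u. u \<in> I \<Longrightarrow> X u \<bullet> a = 0" for t X X'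
    using derivatives_eq_if_eq_on_open
      [OF has_real_derivative_inner[OF that(2) has_vector_derivative_const] DERIV_const[of 0]
        interval(1) that(1)] that(3) by simp
  have T: "T t \<bullet> a = 0" if "t \<in> I" for t
    using step[OF that curve_deriv[OF that]] \<alpha> by blast
  have N: "N t \<bullet> a = 0" if "t \<in> I" for t
    using step[OF that tangent_deriv[OF that] T] \<alpha>[OF that] curvature_pos[OF that]
    by (simp add: inner_diff_left)
  have "\<tau> s * (B s \<bullet> a) = 0"
    using step[OF s normal_deriv[OF s] N] T[OF s] by (simp add: inner_diff_left)
  moreover have "B s \<bullet> a \<noteq> 0"
    using norm_frame_components[OF s, of a] a \<alpha>[OF s] T[OF s] N[OF s]
    by (auto simp: inner_commute)
  ultimately show ?thesis by simp
qed

lemma velocity_in_tangent_space: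
  assumes sub: "\<alpha> ` I \<subseteq> M" and s: "s \<in> I"
  shows "T s \<in> tangent_space M (\<alpha> s)"
proof -
  have shift: "((\<lambda>t. s + t) has_real_derivative 1) (at 0)"
    by (auto intro!: derivative_eq_intros)
  have "((\<alpha> \<circ> (\<lambda>t. s + t)) has_vector_derivative 1 *\<^sub>R T s) (at 0)"
    by (rule vector_diff_chain_at)
      (use shift curve_deriv[OF s] in \<open>auto simp: has_real_derivative_iff_has_vector_derivative\<close>)
  moreover have "eventually (\<lambda>t. s + t \<in> I) (nhds (0::real))"
    by (rule eventually_compose_filterlim[OF eventually_nhds_in_open[OF interval(1) s]])
      (auto intro!: tendsto_eq_intros filterlim_ident)
  then have "eventually (\<lambda>t. \<alpha> (s + t) \<in> M) (nhds (0::real))"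
    by (rule eventually_mono) (use sub in auto)
  ultimately show ?thesis
    unfolding tangent_space_def
    by (intro CollectI exI[of _ "\<alpha> \<circ> (\<lambda>t. s + t)"]) (simp add: o_def)
qed

text \<open>By the chain rule \<open>(\<nu> \<circ> \<alpha>)'\<close> is the derivative of \<open>\<nu>\<close> in the direction \<open>T\<close>. The shape operator
  determines its tangential part \<open>- H T\<close>, and its component along \<open>\<alpha>\<close> is \<open>- \<nu> \<bullet> T = 0\<close>.\<close>
lemma unit_normal_along_curve:
  assumes M: "umbilical_with_mean_curvature M H" and sub: "\<alpha> ` I \<subseteq> M"
  obtains n where
    "\<And>s. s \<in> I \<Longrightarrow> norm (n s) = 1"
    "\<And>s. s \<in> I \<Longrightarrow> n s \<bullet> \<alpha> s = 0"
    "\<And>s. s \<in> I \<Longrightarrow> n s \<bullet> T s = 0"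
    "\<And>s. s \<in> I \<Longrightarrow> (n has_vector_derivative - H *\<^sub>R T s) (at s)"
proof -
  obtain \<nu> where
    \<nu>: "\<forall>p\<in>M. norm (\<nu> p) = 1 \<and> \<nu> p \<bullet> p = 0 \<and> (\<forall>v\<in>tangent_space M p. \<nu> p \<bullet> v = 0)"
    and shape: "\<forall>p\<in>M. \<exists>D. (\<nu> has_derivative D) (at p within M) \<and>
                     (\<forall>v\<in>tangent_space M p. - tangential p (D v) = H *\<^sub>R v)"
    using M unfolding umbilical_with_mean_curvature_def by blast
  define n where "n = \<nu> \<circ> \<alpha>"
  have in_M: "\<alpha> s \<in> M" if "s \<in> I" for s using sub that by blast
  note tan = velocity_in_tangent_space[OF sub]
  have orth: "n s \<bullet> \<alpha> s = 0" "n s \<bullet> T s = 0" and unit: "norm (n s) = 1" if "s \<in> I" for s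
    using \<nu> in_M[OF that] tan[OF that] by (auto simp: n_def)
  have deriv: "(n has_vector_derivative - H *\<^sub>R T s) (at s)" if s: "s \<in> I" for s
  proof -
    obtain D where D: "(\<nu> has_derivative D) (at (\<alpha> s) within M)"
      and DT: "- tangential (\<alpha> s) (D (T s)) = H *\<^sub>R T s"
      using shape in_M[OF s] tan[OF s] by blast
    have lin: "linear D"
      using D has_derivative_linear by blast
    have \<alpha>: "(\<alpha> has_derivative (\<lambda>h. h *\<^sub>R T s)) (at s within I)"
      using curve_deriv[OF s] by (simp add: has_vector_derivative_def has_derivative_at_withinI)
    \<comment> \<open>The field \<open>\<nu>\<close> is differentiable only within \<open>M\<close>; the curve on \<open>I\<close> stays in \<open>M\<close>.\<close>
    have "(n has_derivative (D \<circ> (\<lambda>h. h *\<^sub>R T s))) (at s within I)"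
      unfolding n_def by (rule diff_chain_within[OF \<alpha> has_derivative_subset[OF D sub]])
    then have "(n has_derivative (D \<circ> (\<lambda>h. h *\<^sub>R T s))) (at s)"
      by (simp only: at_within_open[OF s interval(1)])
    moreover have "D \<circ> (\<lambda>h. h *\<^sub>R T s) = (\<lambda>h. h *\<^sub>R D (T s))"
      by (rule ext) (simp only: o_apply linear_scale[OF lin])
    ultimately have n: "(n has_vector_derivative D (T s)) (at s)"
      by (simp only: has_vector_derivative_def)
    have "covariant_deriv \<alpha> n s = - H *\<^sub>R T s"
      using DT vector_derivative_at[OF n] by (simp add: covariant_deriv_def minus_equation_iff)
    moreover have "n differentiable (at s)"
      using n by (rule differentiableI_vector)
    ultimately show ?thesis
      using derivative_of_section[OF s, of n] orth s by simp
  qed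
  from that[OF unit orth deriv] show ?thesis .
qed

text \<open>The identity expresses \<open>|n|\<^sup>2 = 1\<close> in the frame, up to the factor \<open>H\<^sup>2\<close>. The
  factor can be divided out: for \<open>H = 0\<close> all components of \<open>n\<close> in the frame would vanish.\<close>
lemma umbilical_curvature_torsion_identity:
  assumes M: "umbilical_with_mean_curvature M H" and sub: "\<alpha> ` I \<subseteq> M"
    and \<tau>: "\<forall>s\<in>I. \<tau> s \<noteq> 0" and s: "s \<in> I"
  shows "1 / (\<kappa> s)\<^sup>2 + (deriv \<kappa> s)\<^sup>2 / ((\<kappa> s) ^ 4 * (\<tau> s)\<^sup>2) = 1 / H\<^sup>2"
proof -
  obtain n where n: "\<And>s. s \<in> I \<Longrightarrow> norm (n s) = 1" "\<And>s. s \<in> I \<Longrightarrow> n s \<bullet> \<alpha> s = 0"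
    "\<And>s. s \<in> I \<Longrightarrow> n s \<bullet> T s = 0"
    "\<And>s. s \<in> I \<Longrightarrow> (n has_vector_derivative - H *\<^sub>R T s) (at s)"
    using unit_normal_along_curve[OF M sub] by blast
  \<comment> \<open>Differentiate \<open>n \<bullet> T = 0\<close>.\<close>
  have nN: "n t \<bullet> N t = H * (1 / \<kappa> t)" if t: "t \<in> I" for t
  proof -
    have "\<kappa> t * (n t \<bullet> N t) - H = 0"
      using derivatives_eq_if_eq_on_open[OF has_real_derivative_inner
          [OF n(4)[OF t] tangent_deriv[OF t]] DERIV_const[of 0] interval(1) t] n(2,3) t
      by (simp add: inner_diff_right orthonormal)
    then show ?thesis
      using curvature_pos[OF t] by (simp add: field_simps)
  qed
  \<comment> \<open>Differentiate \<open>n \<bullet> N = H / \<kappa>\<close>.\<close>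
  have "\<tau> s * (n s \<bullet> B s) = H * (- deriv \<kappa> s / (\<kappa> s)\<^sup>2)"
    using derivatives_eq_if_eq_on_open[OF has_real_derivative_inner
        [OF n(4)[OF s] normal_deriv[OF s]] DERIV_cmult[OF radius_deriv[OF s]] interval(1) s nN] n(3)[OF s]
    by (simp add: inner_diff_right orthonormal[OF s])
  then have nB: "n s \<bullet> B s = - H * deriv \<kappa> s / ((\<kappa> s)\<^sup>2 * \<tau> s)"
    using \<tau> s curvature_pos[OF s] by (simp add: field_simps)
  have "1 = (H * (1 / \<kappa> s))\<^sup>2 + (- H * deriv \<kappa> s / ((\<kappa> s)\<^sup>2 * \<tau> s))\<^sup>2"
    using norm_frame_components[OF s, of "n s"] n(1-3)[OF s] nN[OF s] nB by simp
  also have "\<dots> = H\<^sup>2 * (1 / (\<kappa> s)\<^sup>2 + (deriv \<kappa> s)\<^sup>2 / ((\<kappa> s) ^ 4 * (\<tau> s)\<^sup>2))"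
    by (simp add: power_mult_distrib power_divide distrib_left flip: power_mult)
  finally have id: "1 = H\<^sup>2 * (1 / (\<kappa> s)\<^sup>2 + (deriv \<kappa> s)\<^sup>2 / ((\<kappa> s) ^ 4 * (\<tau> s)\<^sup>2))" .
  then have "H\<^sup>2 \<noteq> 0"
    by auto
  with id show ?thesis
    by (metis nonzero_mult_div_cancel_left)
qed

section \<open>Curves characterized by curvature and torsion\<close>

lemma in_great_sphere_if_torsion_zero:
  assumes \<tau>: "\<forall>s\<in>I. \<tau> s = 0"
  shows "\<exists>M. totally_geodesic_sphere M \<and> \<alpha> ` I \<subseteq> M"
proof -
  have "(B has_vector_derivative 0) (at s within I)" if "s \<in> I" for s
    using binormal_deriv[OF that] \<tau> that by (simp add: has_vector_derivative_at_within)
  then obtain b where b: "\<And>s. s \<in> I \<Longrightarrow> B s = b"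
    using has_vector_derivative_zero_constant[OF interval(2)] by blast
  have "norm b = 1"
    using interval(3) b orthonormal(4) by (metis equals0I norm_eq_1)
  moreover have "\<alpha> ` I \<subseteq> umbilical b 0"
    using b orthonormal(7) on_S3 by (force simp: umbilical_def)
  ultimately show ?thesis
    unfolding totally_geodesic_sphere_def by blast
qed

text \<open>The vector \<open>A\<close> below is constant, and \<open>\<alpha> \<bullet> A = 1\<close>. Scaling it to the unit vector
  \<open>a = A / \<surd>(1 + C)\<close> gives \<open>\<sigma> = 1 / \<surd>(1 + C)\<close>, so that \<open>H = \<sigma> / \<surd>(1 - \<sigma>\<^sup>2) = 1 / \<surd>C\<close>.\<close>
lemma in_geodesic_sphere_if_identity:
  assumes C: "C > 0" and nz: "\<forall>s\<in>I. \<tau> s \<noteq> 0 \<and> deriv \<kappa> s \<noteq> 0"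
    and id: "\<forall>s\<in>I. 1 / (\<kappa> s)\<^sup>2 + (deriv \<kappa> s)\<^sup>2 / ((\<kappa> s) ^ 4 * (\<tau> s)\<^sup>2) = C"
  shows "\<exists>M H. geodesic_sphere M \<and> umbilical_with_mean_curvature M H \<and> C = 1 / H\<^sup>2 \<and> \<alpha> ` I \<subseteq> M"
proof -
  define \<rho> where "\<rho> s = 1 / \<kappa> s" for s
  define \<mu> where "\<mu> s = - deriv \<kappa> s / ((\<kappa> s)\<^sup>2 * \<tau> s)" for s
  define A where "A s = \<alpha> s + \<rho> s *\<^sub>R N s + \<mu> s *\<^sub>R B s" for s
  have \<rho>: "(\<rho> has_real_derivative \<mu> s * \<tau> s) (at s)" and \<rho>\<kappa>: "\<rho> s * \<kappa> s = 1" and \<mu>0: "\<mu> s \<noteq> 0"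
    if "s \<in> I" for s
    using radius_deriv[OF that] curvature_pos[OF that] nz that
    by (auto simp: \<rho>_def[abs_def] \<mu>_def)
  have sum: "(\<rho> s)\<^sup>2 + (\<mu> s)\<^sup>2 = C" if "s \<in> I" for s
    using id that
    by (simp add: \<rho>_def \<mu>_def power_mult_distrib power_divide flip: power_mult)
  have "(A has_vector_derivative 0) (at s within I)" if s: "s \<in> I" for s
  proof -
    have "\<mu> differentiable (at s)"
      unfolding \<mu>_def using nz s curvature_pos[OF s]
      by (intro derivative_intros curvature_torsion_differentiable[OF s]) auto
    then obtain m where m: "(\<mu> has_real_derivative m) (at s)"
      using real_differentiable_def by blast
    \<comment> \<open>Differentiate \<open>\<rho>\<^sup>2 + \<mu>\<^sup>2 = C\<close>, where \<open>\<rho>' = \<mu>\<tau>\<close>, and cancel \<open>\<mu> \<noteq> 0\<close>.\<close>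
    have "((\<lambda>t. (\<rho> t)\<^sup>2 + (\<mu> t)\<^sup>2) has_real_derivative 2 * \<mu> s * (\<rho> s * \<tau> s + m)) (at s)"
      by (auto intro!: derivative_eq_intros \<rho>[OF s] m simp: algebra_simps)
    from derivatives_eq_if_eq_on_open[OF this DERIV_const interval(1) s sum]
    have m': "\<rho> s * \<tau> s + m = 0"
      using \<mu>0[OF s] by simp
    have "(A has_vector_derivative T s +
        (\<rho> s *\<^sub>R (- \<kappa> s *\<^sub>R T s + \<tau> s *\<^sub>R B s) + (\<mu> s * \<tau> s) *\<^sub>R N s) +
        (\<mu> s *\<^sub>R (- \<tau> s *\<^sub>R N s) + m *\<^sub>R B s)) (at s)"
      unfolding A_def
      by (intro has_vector_derivative_add has_vector_derivative_scaleR curve_deriv normal_deriv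
          binormal_deriv \<rho> m s)
    also have "T s + (\<rho> s *\<^sub>R (- \<kappa> s *\<^sub>R T s + \<tau> s *\<^sub>R B s) + (\<mu> s * \<tau> s) *\<^sub>R N s) +
        (\<mu> s *\<^sub>R (- \<tau> s *\<^sub>R N s) + m *\<^sub>R B s)
      = (1 - \<rho> s * \<kappa> s) *\<^sub>R T s + (\<rho> s * \<tau> s + m) *\<^sub>R B s"
      by (simp add: algebra_simps)
    also have "\<dots> = 0"
      by (simp add: \<rho>\<kappa>[OF s] m')
    finally show ?thesis
      by (rule has_vector_derivative_at_within)
  qed
  then obtain c where c: "\<And>s. s \<in> I \<Longrightarrow> A s = c"
    using has_vector_derivative_zero_constant[OF interval(2)] by blast
  have A\<alpha>: "\<alpha> s \<bullet> A s = 1" and AA: "(norm (A s))\<^sup>2 = 1 + C" if "s \<in> I" for s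
    using sum[OF that]
    by (simp_all only: A_def power2_norm_eq_inner inner_add_left inner_add_right inner_scaleR_left
        inner_scaleR_right orthonormal[OF that]) (simp_all add: power2_eq_square)
  define r where "r = sqrt (1 + C)"
  have r: "r > 1" "r\<^sup>2 = 1 + C"
    using C by (auto simp: r_def)
  have "norm c = r"
    using interval(3) AA c r by (metis abs_norm_cancel equals0I r_def real_sqrt_abs)
  define a where "a = (1 / r) *\<^sub>R c"
  define \<sigma> where "\<sigma> = 1 / r"
  have a: "norm a = 1"
    using \<open>norm c = r\<close> r by (simp add: a_def)
  have \<sigma>: "- 1 < \<sigma>" "\<sigma> < 1" "\<sigma> \<noteq> 0"
    using r less_trans[of "- 1" 0 "1 / r"] by (simp_all add: \<sigma>_def)
  have "\<alpha> ` I \<subseteq> umbilical a \<sigma>"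
    using A\<alpha> c on_S3 by (force simp: umbilical_def a_def \<sigma>_def)
  moreover have "C = 1 / (\<sigma> / sqrt (1 - \<sigma>\<^sup>2))\<^sup>2"
  proof -
    have "1 - \<sigma>\<^sup>2 = C / r\<^sup>2"
      using r C by (simp add: \<sigma>_def power_divide field_simps)
    then have "(\<sigma> / sqrt (1 - \<sigma>\<^sup>2))\<^sup>2 = \<sigma>\<^sup>2 / (C / r\<^sup>2)"
      using C by (simp add: power_divide)
    also have "\<dots> = 1 / C"
      using r C by (simp add: \<sigma>_def power_divide)
    finally show ?thesis using C by simp
  qed
  ultimately show ?thesis
    using a \<sigma> umbilical_mean_curvature[OF a \<sigma>(1,2)] unfolding geodesic_sphere_def by blast
qed

end

theorem theorem1p3:
  fixes \<alpha> T N B :: "real \<Rightarrow> real^4" and \<kappa> \<tau> :: "real \<Rightarrow> real" and I :: "real set" and \<epsilon> :: real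
  assumes "\<epsilon> = 1 \<or> \<epsilon> = -1"
    and "arclength_curve I \<alpha>"
    and "frenet_frame \<epsilon> I \<alpha> T N B \<kappa> \<tau>"
  shows
    "(\<forall>(a::real^4). norm a = 1 \<and> \<alpha> ` I \<subseteq> umbilical a 0 \<longrightarrow> (\<forall>s\<in>I. \<tau> s = 0)) \<and>
     (\<forall>(a::real^4) \<sigma> H. norm a = 1 \<and> -1 < \<sigma> \<and> \<sigma> < 1 \<and> \<sigma> \<noteq> 0 \<and>
        umbilical_with_mean_curvature (umbilical a \<sigma>) H \<and>
        \<alpha> ` I \<subseteq> umbilical a \<sigma> \<and> (\<forall>s\<in>I. \<tau> s \<noteq> 0) \<longrightarrow>
        (\<forall>s\<in>I. 1 / (\<kappa> s)\<^sup>2 + (deriv \<kappa> s)\<^sup>2 / ((\<kappa> s) ^ 4 * (\<tau> s)\<^sup>2) = 1 / H\<^sup>2)) \<and>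
     ((\<forall>s\<in>I. \<tau> s = 0) \<longrightarrow> (\<exists>M. totally_geodesic_sphere M \<and> \<alpha> ` I \<subseteq> M)) \<and>
     (\<forall>C. C > 0 \<and> (\<forall>s\<in>I. \<tau> s \<noteq> 0 \<and> deriv \<kappa> s \<noteq> 0) \<and>
        (\<forall>s\<in>I. 1 / (\<kappa> s)\<^sup>2 + (deriv \<kappa> s)\<^sup>2 / ((\<kappa> s) ^ 4 * (\<tau> s)\<^sup>2) = C) \<longrightarrow>
        (\<exists>M H. geodesic_sphere M \<and> umbilical_with_mean_curvature M H \<and> C = 1 / H\<^sup>2 \<and> \<alpha> ` I \<subseteq> M))"
proof -
  interpret frenet_curve \<alpha> T N B \<kappa> \<tau> I \<epsilon>
    by (rule frenet_curve.intro) fact+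
  show ?thesis
  proof (intro conjI)
    show "\<forall>(a::real^4). norm a = 1 \<and> \<alpha> ` I \<subseteq> umbilical a 0 \<longrightarrow> (\<forall>s\<in>I. \<tau> s = 0)"
      using torsion_zero_if_in_great_sphere by blast
  next
    show "\<forall>(a::real^4) \<sigma> H. norm a = 1 \<and> -1 < \<sigma> \<and> \<sigma> < 1 \<and> \<sigma> \<noteq> 0 \<and>
        umbilical_with_mean_curvature (umbilical a \<sigma>) H \<and>
        \<alpha> ` I \<subseteq> umbilical a \<sigma> \<and> (\<forall>s\<in>I. \<tau> s \<noteq> 0) \<longrightarrow>
        (\<forall>s\<in>I. 1 / (\<kappa> s)\<^sup>2 + (deriv \<kappa> s)\<^sup>2 / ((\<kappa> s) ^ 4 * (\<tau> s)\<^sup>2) = 1 / H\<^sup>2)"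
      using umbilical_curvature_torsion_identity by blast
  next
    show "(\<forall>s\<in>I. \<tau> s = 0) \<longrightarrow> (\<exists>M. totally_geodesic_sphere M \<and> \<alpha> ` I \<subseteq> M)"
      using in_great_sphere_if_torsion_zero by blast
  next
    show "\<forall>C. C > 0 \<and> (\<forall>s\<in>I. \<tau> s \<noteq> 0 \<and> deriv \<kappa> s \<noteq> 0) \<and>
        (\<forall>s\<in>I. 1 / (\<kappa> s)\<^sup>2 + (deriv \<kappa> s)\<^sup>2 / ((\<kappa> s) ^ 4 * (\<tau> s)\<^sup>2) = C) \<longrightarrow>
        (\<exists>M H. geodesic_sphere M \<and> umbilical_with_mean_curvature M H \<and> C = 1 / H\<^sup>2 \<and> \<alpha> ` I \<subseteq> M)"
      using in_geodesic_sphere_if_identity by blast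
  qed
qed

end
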